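(* Let $d\ge 1$, let $S$ be a finite symmetric generating set of $\mathbb{Z}^d$, and let $p>0$. Then the expected value of $|\mathsf{x}|^p$ over $B_n$, normalized by $n^p$, tends to $\frac{d}{d+p}$: $$\lim_{n\to\infty}\frac{1}{|B_n|}\sum_{\mathsf{x}\in B_n}\frac{|\mathsf{x}|^p}{n^p}=\frac{d}{d+p}.$$
   Context: Symmetric means $S=-S$. The word length $|\mathsf{x}|$ of $\mathsf{x}\in\mathbb{Z}^d$ is the minimal number of elements of $S$ (with repetition) summing to $\mathsf{x}$; $B_n=\{\mathsf{x}\in\mathbb{Z}^d: |\mathsf{x}|\le n\}$, and $|B_n|$ is its cardinality. *)

theory Defs
  imports "HOL-Analysis.Analysis" "HOL-Computational_Algebra.Group_Closure"
begin

(* A word is a list, so that repetitions count; since the group is abelian the order of the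
   letters is irrelevant. For x not representable over S the value is an unspecified natural
   number; see word_lengthE. *)
definition word_length :: "'a::ab_group_add set \<Rightarrow> 'a \<Rightarrow> nat" where
  "word_length S x = (LEAST k. \<exists>w. length w = k \<and> set w \<subseteq> S \<and> sum_list w = x)"

definition word_ball :: "'a::ab_group_add set \<Rightarrow> nat \<Rightarrow> 'a set" where
  "word_ball S n = {x. word_length S x \<le> n}"

lemma sum_list_map_uminus: "sum_list (map uminus w) = - sum_list w"
  for w :: "'a::ab_group_add list"
  by (induction w) auto

lemma exists_word:
  assumes sym: "uminus ` S = S" and x: "x \<in> group_closure S"
  shows "\<exists>w. set w \<subseteq> S \<and> sum_list w = x"
  using x
proof (induction rule: group_closure.induct)
  case (base s)
  show ?case
  proof (cases "s = 0")
    case True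
    then show ?thesis by (intro exI[of _ "[]"]) simp
  next
    case False
    with base show ?thesis by (intro exI[of _ "[s]"]) simp
  qed
next
  case (diff s t)
  then obtain v w where "set v \<subseteq> S" "sum_list v = s" "set w \<subseteq> S" "sum_list w = t"
    by blast
  with sym show ?case
    by (intro exI[of _ "v @ map uminus w"]) (auto simp: sum_list_map_uminus)
qed

(* For a symmetric generating set the minimum defining the word length is attained. *)
lemma word_lengthE:
  assumes "uminus ` S = S" and "group_closure S = UNIV"
  obtains w where "length w = word_length S x" "set w \<subseteq> S" "sum_list w = x"
proof -
  have "\<exists>k w. length w = k \<and> set w \<subseteq> S \<and> sum_list w = x"
    using exists_word[of S x] assms by auto
  from LeastI_ex[OF this] show thesis
    using that unfolding word_length_def by blast
qed

(* Hence card and sum over word_ball are not degenerate. *)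
lemma finite_word_ball:
  assumes "finite S" and "uminus ` S = S" and "group_closure S = UNIV"
  shows "finite (word_ball S n)"
proof (rule finite_subset)
  show "word_ball S n \<subseteq> sum_list ` {w. set w \<subseteq> S \<and> length w \<le> n}"
  proof
    fix x assume x: "x \<in> word_ball S n"
    obtain w where "length w = word_length S x" "set w \<subseteq> S" "sum_list w = x"
      using word_lengthE[OF assms(2,3)] .
    with x show "x \<in> sum_list ` {w. set w \<subseteq> S \<and> length w \<le> n}"
      by (auto simp: word_ball_def)
  qed
  show "finite (sum_list ` {w. set w \<subseteq> S \<and> length w \<le> n})"
    using finite_lists_length_le[OF assms(1)] by simp
qed

end

(* The balls are squeezed between dilates of the polytope P = conv (S \<union> {0}): if |x| \<le> n then
   x \<in> nP, and conversely a lattice point of tP has word length at most t + O(1).  Comparing lattice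
   points with unit cubes gives |B_n| ~ vol(P) n^d.  Abel summation expresses the p-th moment of
   the word length over B_n through the cardinalities |B_k|, k \<le> n, and the Stolz-Cesaro theorem
   yields the limit 1 - p / (d + p). *)

theory Submission
  imports Defs "HOL-Real_Asymp.Real_Asymp"
begin

section \<open>The Stolz-Cesaro theorem and Abel summation\<close>

text \<open>Past some index \<open>N\<close> the increments of \<open>a - L * c\<close> are at most
  \<open>e / 2\<close> times those of \<open>c\<close>. Telescoping turns this into a bound by
  \<open>e / 2 * (c n - c N)\<close>, and dividing by \<open>c n\<close> makes the fixed terms at
  \<open>N\<close> negligible.\<close>

lemma stolz_cesaro:
  fixes a c :: "nat \<Rightarrow> real"
  assumes c_mono: "strict_mono c" and c_top: "filterlim c at_top sequentially"
    and lim: "(\<lambda>n. (a (Suc n) - a n) / (c (Suc n) - c n)) \<longlonglongrightarrow> L"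
  shows "(\<lambda>n. a n / c n) \<longlonglongrightarrow> L"
proof (rule LIMSEQ_I)
  fix e :: real assume "e > 0"
  define h where "h n = a n - L * c n" for n
  obtain N where N: "\<bar>(a (Suc n) - a n) / (c (Suc n) - c n) - L\<bar> < e / 2" if "n \<ge> N" for n
    using LIMSEQ_D[OF lim, of "e / 2"] \<open>e > 0\<close> by auto
  have increment: "\<bar>h (Suc n) - h n\<bar> \<le> e / 2 * (c (Suc n) - c n)" if "n \<ge> N" for n
  proof -
    have pos: "c (Suc n) - c n > 0"
      using c_mono by (simp add: strict_mono_Suc_iff)
    have "h (Suc n) - h n
        = ((a (Suc n) - a n) / (c (Suc n) - c n) - L) * (c (Suc n) - c n)"
      using pos by (simp add: h_def field_simps)
    then have "\<bar>h (Suc n) - h n\<bar>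
        = \<bar>(a (Suc n) - a n) / (c (Suc n) - c n) - L\<bar> * (c (Suc n) - c n)"
      using pos by (simp only: abs_mult)
    then show ?thesis
      using N[OF that] pos by (simp add: mult_right_mono)
  qed
  have h_bound: "\<bar>h n - h N\<bar> \<le> e / 2 * (c n - c N)" if "n \<ge> N" for n
    using that
  proof (induction n rule: dec_induct)
    case (step n)
    then show ?case
      using step.IH increment[of n]
      unfolding right_diff_distrib by linarith
  qed simp
  \<comment> \<open>The threshold makes \<open>c n\<close> positive and lets the terms at
    \<open>N\<close> cost at most another \<open>e / 2 * c n\<close>.\<close>
  have "eventually (\<lambda>n. c n > max 0 (2 / e * (\<bar>h N\<bar> + e / 2 * \<bar>c N\<bar>))) sequentially"
    using c_top unfolding filterlim_at_top_dense by blast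
  then have "eventually (\<lambda>n. norm (a n / c n - L) < e) sequentially"
    using eventually_ge_at_top[of N]
  proof eventually_elim
    case (elim n)
    then have pos: "c n > 0"
      by simp
    have big: "\<bar>h N\<bar> + e / 2 * \<bar>c N\<bar> < e / 2 * c n"
      using elim(1) \<open>e > 0\<close> by (simp add: field_simps)
    have "e / 2 * (c n - c N) \<le> e / 2 * c n + e / 2 * \<bar>c N\<bar>"
      using \<open>e > 0\<close> by (simp add: algebra_simps) (smt (verit) mult_minus_right mult_left_mono)
    then have "\<bar>h n\<bar> < e * c n"
      using h_bound[OF elim(2)] big by linarith
    moreover have "a n / c n - L = h n / c n"
      using pos by (simp add: h_def field_simps)
    ultimately show ?case
      using pos by (simp add: divide_less_eq)
  qed
  then show "\<exists>N. \<forall>n\<ge>N. norm (a n / c n - L) < e"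
    by (simp add: eventually_sequentially)
qed

text \<open>The numerator grows like \<open>p\<close> and the denominator like \<open>d + p\<close>
  times the power of \<open>n\<close> with exponent \<open>d + p - 1\<close>.\<close>

lemma powr_difference_ratio_tendsto:
  fixes d p :: real
  assumes "d > 0" "p > 0"
  shows "(\<lambda>n. real n powr d * (real (Suc n) powr p - real n powr p) /
            (real (Suc n) powr (d + p) - real n powr (d + p))) \<longlonglongrightarrow> p / (d + p)"
proof -
  have "(\<lambda>n. real n powr d * ((real n + 1) powr p - real n powr p) /
      ((real n + 1) powr (d + p) - real n powr (d + p))) \<longlonglongrightarrow> p * inverse (d + p)"
    using assms by real_asymp
  then show ?thesis
    by (simp add: divide_inverse add.commute)
qed

text \<open>In Stolz-Cesaro against \<open>real n powr (d + p)\<close>, the quotient of increments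
  factors into \<open>b n / real n powr d\<close> and the ratio treated just before.\<close>

lemma weighted_sum_asymptotics:
  fixes b :: "nat \<Rightarrow> real" and d p :: real
  assumes "d > 0" "p > 0" and lim: "(\<lambda>n. b n / real n powr d) \<longlonglongrightarrow> V"
  shows "(\<lambda>n. (\<Sum>k<n. b k * (real (Suc k) powr p - real k powr p)) / real n powr (d + p))
    \<longlonglongrightarrow> V * (p / (d + p))"
proof (rule stolz_cesaro)
  show "strict_mono (\<lambda>n. real n powr (d + p))"
    using assms by (auto intro!: strict_monoI powr_less_mono2)
  show "filterlim (\<lambda>n. real n powr (d + p)) at_top sequentially"
    using assms by real_asymp
  have "(\<lambda>n. (b n / real n powr d) * (real n powr d * (real (Suc n) powr p - real n powr p) /
            (real (Suc n) powr (d + p) - real n powr (d + p)))) \<longlonglongrightarrow> V * (p / (d + p))"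
    using lim powr_difference_ratio_tendsto[OF assms(1,2)] by (rule tendsto_mult)
  then show "(\<lambda>n. ((\<Sum>k<Suc n. b k * (real (Suc k) powr p - real k powr p))
        - (\<Sum>k<n. b k * (real (Suc k) powr p - real k powr p))) /
      (real (Suc n) powr (d + p) - real n powr (d + p))) \<longlonglongrightarrow> V * (p / (d + p))"
    \<comment> \<open>The factor \<open>real n powr d\<close> cancels only for
      \<open>n > 0\<close>.\<close>
    by (rule Lim_transform_eventually)
      (use eventually_gt_at_top[of 0] in eventually_elim, simp)
qed

text \<open>Abel summation: going from \<open>n\<close> to \<open>Suc n\<close> adds the level set
  of value \<open>Suc n\<close>, while the points already counted have their factor changed from
  \<open>real n powr p\<close> to \<open>real (Suc n) powr p\<close>, which the new summand
  compensates.\<close>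

lemma sum_powr_sublevels:
  fixes f :: "'a \<Rightarrow> nat" and p :: real
  assumes fin: "\<And>n. finite {x. f x \<le> n}"
  shows "(\<Sum>x | f x \<le> n. real (f x) powr p) = real n powr p * card {x. f x \<le> n}
    - (\<Sum>k<n. card {x. f x \<le> k} * (real (Suc k) powr p - real k powr p))"
proof (induction n)
  \<comment> \<open>Both sides vanish, since \<open>0 powr p = 0\<close> for every
    \<open>p\<close>.\<close>
  case 0
  then show ?case by simp
next
  case (Suc n)
  have split: "{x. f x \<le> Suc n} = {x. f x \<le> n} \<union> {x. f x = Suc n}"
    by auto
  have fin': "finite {x. f x = Suc n}"
    by (rule finite_subset[OF _ fin[of "Suc n"]]) auto
  have "card {x. f x \<le> Suc n} = card {x. f x \<le> n} + card {x. f x = Suc n}"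
    unfolding split using fin fin' by (intro card_Un_disjoint) auto
  moreover have "(\<Sum>x | f x \<le> Suc n. real (f x) powr p)
      = (\<Sum>x | f x \<le> n. real (f x) powr p) + (\<Sum>x | f x = Suc n. real (f x) powr p)"
    unfolding split using fin fin' by (intro sum.union_disjoint) auto
  ultimately show ?case
    using Suc.IH by (simp add: algebra_simps)
qed

text \<open>Dividing the Abel formula by \<open>real n powr p * b n\<close> leaves 1 minus a
  quotient whose numerator and denominator, once normalized, tend to
  \<open>V * (p / (d + p))\<close> and \<open>V\<close>, so the constant \<open>V\<close>
  cancels.\<close>

lemma normalized_moment_tendsto:
  fixes f :: "'a \<Rightarrow> nat" and d p V :: real
  assumes fin: "\<And>n. finite {x. f x \<le> n}" and "d > 0" "p > 0" "V > 0"
    and lim: "(\<lambda>n. card {x. f x \<le> n} / real n powr d) \<longlonglongrightarrow> V"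
  shows "(\<lambda>n. 1 / real (card {x. f x \<le> n}) * (\<Sum>x | f x \<le> n. real (f x) powr p / real n powr p))
    \<longlonglongrightarrow> d / (d + p)"
proof -
  define b where "b n = real (card {x. f x \<le> n})" for n
  define T where "T n = (\<Sum>k<n. b k * (real (Suc k) powr p - real k powr p))" for n
  have lim_b: "(\<lambda>n. b n / real n powr d) \<longlonglongrightarrow> V"
    using lim by (simp add: b_def)
  have "(\<lambda>n. 1 - (T n / real n powr (d + p)) / (b n / real n powr d))
      \<longlonglongrightarrow> 1 - V * (p / (d + p)) / V"
    unfolding T_def using assms
    by (intro tendsto_intros weighted_sum_asymptotics lim_b) auto
  moreover have "1 - V * (p / (d + p)) / V = d / (d + p)"
    using assms by (simp add: divide_simps)
  moreover have "eventually (\<lambda>n. 1 - (T n / real n powr (d + p)) / (b n / real n powr d)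
      = 1 / b n * (\<Sum>x | f x \<le> n. real (f x) powr p / real n powr p)) sequentially"
    \<comment> \<open>Positivity of the limit \<open>V\<close> makes \<open>b n\<close> eventually
      nonzero.\<close>
    using order_tendstoD(1)[OF lim_b \<open>V > 0\<close>] eventually_gt_at_top[of 0]
  proof eventually_elim
    case (elim n)
    then have "b n \<noteq> 0" "real n powr d \<noteq> 0" "real n powr p \<noteq> 0"
      by auto
    moreover have "(\<Sum>x | f x \<le> n. real (f x) powr p) = real n powr p * b n - T n"
      using sum_powr_sublevels[OF fin] by (simp add: b_def T_def)
    ultimately show ?case
      by (simp add: powr_add sum_divide_distrib[symmetric] field_simps)
  qed
  ultimately show ?thesis
    unfolding b_def by (simp add: tendsto_cong)
qed

section \<open>Subadditivity of the word length\<close>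

lemma word_length_le:
  "set w \<subseteq> S \<Longrightarrow> word_length S (sum_list w) \<le> length w"
  unfolding word_length_def by (rule Least_le) blast

context
  fixes S :: "'a::ab_group_add set"
  assumes sym: "uminus ` S = S" and gen: "group_closure S = UNIV"
begin

lemma word_length_zero: "word_length S 0 = 0"
  using word_length_le[of "[]" S] by simp

lemma word_length_add: "word_length S (x + y) \<le> word_length S x + word_length S y"
proof -
  obtain v w where "length v = word_length S x" "set v \<subseteq> S" "sum_list v = x"
    "length w = word_length S y" "set w \<subseteq> S" "sum_list w = y"
    using word_lengthE[OF sym gen] by metis
  then show ?thesis
    using word_length_le[of "v @ w" S] by simp
qed

lemma word_length_sum: "word_length S (\<Sum>i\<in>I. f i) \<le> (\<Sum>i\<in>I. word_length S (f i))"
  by (induction I rule: infinite_finite_induct)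
    (auto simp: word_length_zero intro: order_trans[OF word_length_add])

end

section \<open>Integer vectors and dilates of convex sets\<close>

definition lattice_point :: "int ^ 'd \<Rightarrow> real ^ 'd" where
  "lattice_point x = (\<chi> i. real_of_int (x $ i))"

lemma lattice_point_nth [simp]: "lattice_point x $ i = real_of_int (x $ i)"
  by (simp add: lattice_point_def)

lemma lattice_point_zero [simp]: "lattice_point 0 = 0"
  by (simp add: vec_eq_iff)

lemma lattice_point_add: "lattice_point (x + y) = lattice_point x + lattice_point y"
  by (simp add: vec_eq_iff)

lemma inj_lattice_point: "inj lattice_point"
  by (rule injI) (simp add: vec_eq_iff)

text \<open>This will give the rounding remainders a common bound on their word lengths.\<close>

lemma finite_bounded_int_vectors: "finite {z :: int ^ 'd. \<forall>i. \<bar>z $ i\<bar> \<le> M}"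
proof (rule finite_subset)
  show "{z :: int ^ 'd. \<forall>i. \<bar>z $ i\<bar> \<le> M} \<subseteq> vec_lambda ` (UNIV \<rightarrow>\<^sub>E {-M..M})"
  proof
    fix z :: "int ^ 'd" assume "z \<in> {z. \<forall>i. \<bar>z $ i\<bar> \<le> M}"
    then have "vec_nth z \<in> UNIV \<rightarrow>\<^sub>E {-M..M}"
      by (auto simp: abs_le_iff) (metis minus_le_iff)
    then show "z \<in> vec_lambda ` (UNIV \<rightarrow>\<^sub>E {-M..M})"
      by (metis image_eqI vec_nth_inverse)
  qed
qed (auto intro!: finite_imageI finite_PiE)

text \<open>The sum of \<open>t *\<^sub>R a\<close> and \<open>u *\<^sub>R b\<close> is
  \<open>t + u\<close> times the convex combination with weights \<open>t / (t + u)\<close> and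
  \<open>u / (t + u)\<close>; when \<open>t + u = 0\<close> both summands vanish.\<close>

lemma convex_dilate_add:
  fixes K :: "'a::real_vector set"
  assumes "convex K" "0 \<le> t" "0 \<le> u" "x \<in> (*\<^sub>R) t ` K" "y \<in> (*\<^sub>R) u ` K"
  shows "x + y \<in> (*\<^sub>R) (t + u) ` K"
proof -
  obtain a b where ab: "a \<in> K" "x = t *\<^sub>R a" "b \<in> K" "y = u *\<^sub>R b"
    using assms by blast
  show ?thesis
  proof (cases "t + u = 0")
    case True
    then have "t = 0" "u = 0"
      using assms by auto
    with ab show ?thesis
      by auto
  next
    case False
    then have "(t / (t + u)) *\<^sub>R a + (u / (t + u)) *\<^sub>R b \<in> K"
      using assms ab by (intro convexD) (auto simp: add_divide_distrib[symmetric])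
    moreover have "x + y = (t + u) *\<^sub>R ((t / (t + u)) *\<^sub>R a + (u / (t + u)) *\<^sub>R b)"
      using False ab by (simp add: scaleR_add_right)
    ultimately show ?thesis
      by blast
  qed
qed

lemma convex_dilate_mono:
  fixes K :: "'a::real_vector set"
  assumes "convex K" "0 \<in> K" "0 \<le> t" "t \<le> u" "x \<in> (*\<^sub>R) t ` K"
  shows "x \<in> (*\<^sub>R) u ` K"
  using convex_dilate_add[of K t "u - t" x 0] assms by force

lemma convex_dilate_sum:
  fixes K :: "'a::real_vector set"
  assumes "convex K" "0 \<in> K" "finite I"
    and "\<And>i. i \<in> I \<Longrightarrow> 0 \<le> t i" "\<And>i. i \<in> I \<Longrightarrow> f i \<in> (*\<^sub>R) (t i) ` K"
  shows "(\<Sum>i\<in>I. f i) \<in> (*\<^sub>R) (\<Sum>i\<in>I. t i) ` K"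
  using assms(3-5)
proof (induction I)
  case empty
  then show ?case using assms(2) by force
next
  case (insert i I)
  then show ?case
    by (auto intro!: convex_dilate_add assms(1) sum_nonneg)
qed

section \<open>Comparing volumes with numbers of lattice points\<close>

lemma measure_dilate:
  fixes K :: "(real ^ 'd) set"
  assumes "0 \<le> t"
  shows "measure lebesgue ((*\<^sub>R) t ` K) = t ^ CARD('d) * measure lebesgue K"
  using measure_lebesgue_affine[of t 0 K] assms by simp

text \<open>Here \<open>1\<close> is the all-ones vector, so the boxes are unit cubes with lowest
  corner \<open>a\<close>.\<close>

lemma measure_unit_cube:
  fixes a :: "real ^ 'd"
  shows "measure lebesgue (cbox a (a + 1)) = 1" "measure lebesgue (box a (a + 1)) = 1"
proof -
  have "cbox a (a + 1) \<noteq> {}"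
    by (auto simp: interval_ne_empty_cart)
  then show 1: "measure lebesgue (cbox a (a + 1)) = 1"
    by (simp add: content_cbox_cart)
  then show "measure lebesgue (box a (a + 1)) = 1"
    by (simp add: measure_lborel_box_eq measure_lborel_cbox_eq)
qed

text \<open>Open unit cubes at distinct lattice points are disjoint, so their volumes add up inside
  \<open>A\<close>.\<close>

lemma card_le_measure:
  fixes B :: "(int ^ 'd) set"
  assumes "finite B" "A \<in> lmeasurable"
    and cubes: "\<And>x. x \<in> B \<Longrightarrow> box (lattice_point x) (lattice_point x + 1) \<subseteq> A"
  shows "real (card B) \<le> measure lebesgue A"
proof -
  have disj: "disjnt (box (lattice_point x) (lattice_point x + 1)) (box (lattice_point y) (lattice_point y + 1))"
    if "x \<noteq> y" for x y :: "int ^ 'd"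
  proof -
    have "x = y" if z: "z \<in> box (lattice_point x) (lattice_point x + 1)"
      "z \<in> box (lattice_point y) (lattice_point y + 1)" for z
    proof (rule vec_eq_iff[THEN iffD2, rule_format])
      fix i
      have "real_of_int (x $ i) < z $ i" "z $ i < real_of_int (x $ i) + 1"
        "real_of_int (y $ i) < z $ i" "z $ i < real_of_int (y $ i) + 1"
        using z by (auto simp: mem_box_cart)
      then show "x $ i = y $ i"
        by linarith
    qed
    with that show ?thesis
      by (auto simp: disjnt_iff)
  qed
  have "real (card B) = (\<Sum>x\<in>B. measure lebesgue (box (lattice_point x) (lattice_point x + 1)))"
    by (simp only: measure_unit_cube) simp
  also have "\<dots> = measure lebesgue (\<Union>x\<in>B. box (lattice_point x) (lattice_point x + 1))"
    using disj assms(1) by (intro measure_UNION'[symmetric]) (auto simp: pairwise_def)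
  also have "\<dots> \<le> measure lebesgue A"
    using cubes assms(1,2) by (intro measure_mono_fmeasurable) (auto intro!: sets.finite_UN)
  finally show ?thesis .
qed

text \<open>Closed cubes may overlap in faces, but subadditivity of the measure suffices
  here.\<close>

lemma measure_le_card:
  fixes B :: "(int ^ 'd) set"
  assumes "finite B" "A \<in> lmeasurable"
    and cubes: "A \<subseteq> (\<Union>x\<in>B. cbox (lattice_point x) (lattice_point x + 1))"
  shows "measure lebesgue A \<le> real (card B)"
proof -
  have "measure lebesgue A \<le> measure lebesgue (\<Union>x\<in>B. cbox (lattice_point x) (lattice_point x + 1))"
    using assms by (intro measure_mono_fmeasurable fmeasurable.finite_UN) auto
  also have "\<dots> \<le> (\<Sum>x\<in>B. measure lebesgue (cbox (lattice_point x) (lattice_point x + 1)))"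
    using assms(1) by (intro measure_UNION_le) auto
  also have "\<dots> = real (card B)"
    by (simp only: measure_unit_cube) simp
  finally show ?thesis .
qed

text \<open>A bounded change of the dilation factor does not affect the leading term:
  \<open>(real n - c) / real n\<close> and \<open>(real n + c) / real n\<close> both tend to
  1.\<close>

lemma power_sandwich_tendsto:
  fixes b :: "nat \<Rightarrow> real"
  assumes "\<And>n. real n \<ge> c \<Longrightarrow> (real n - c) ^ d * V \<le> b n"
    and "\<And>n. b n \<le> (real n + c) ^ d * V"
  shows "(\<lambda>n. b n / real n ^ d) \<longlonglongrightarrow> V"
proof (rule tendsto_sandwich)
  have "(\<lambda>n. ((real n - c) / real n) ^ d * V) \<longlonglongrightarrow> 1 ^ d * V"
    by (intro tendsto_intros) real_asymp
  then show "(\<lambda>n. ((real n - c) / real n) ^ d * V) \<longlonglongrightarrow> V"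
    by simp
  have "(\<lambda>n. ((real n + c) / real n) ^ d * V) \<longlonglongrightarrow> 1 ^ d * V"
    by (intro tendsto_intros) real_asymp
  then show "(\<lambda>n. ((real n + c) / real n) ^ d * V) \<longlonglongrightarrow> V"
    by simp
  show "\<forall>\<^sub>F n in sequentially. ((real n - c) / real n) ^ d * V \<le> b n / real n ^ d"
    using eventually_ge_at_top[of "nat \<lceil>c\<rceil>"]
  proof eventually_elim
    case (elim n)
    then have "real n \<ge> c" by linarith
    from divide_right_mono[OF assms(1)[OF this], of "real n ^ d"] show ?case
      by (simp add: power_divide)
  qed
  show "\<forall>\<^sub>F n in sequentially. b n / real n ^ d \<le> ((real n + c) / real n) ^ d * V"
    using divide_right_mono[OF assms(2), of "real _ ^ d"]
    by (intro always_eventually) (simp add: power_divide)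
qed

section \<open>The polytope spanned by the generators\<close>

text \<open>Including the origin makes the dilates increase with the factor, as
  \<open>convex_dilate_mono\<close> requires.\<close>

definition word_polytope :: "(int ^ 'd) set \<Rightarrow> (real ^ 'd) set" where
  "word_polytope S = convex hull (lattice_point ` insert 0 S)"

context
  fixes S :: "(int ^ 'd) set"
  assumes fin: "finite S" and sym: "uminus ` S = S" and gen: "group_closure S = UNIV"
begin

lemma convex_word_polytope: "convex (word_polytope S)"
  by (simp add: word_polytope_def)

lemma lattice_point_in_word_polytope: "s \<in> insert 0 S \<Longrightarrow> lattice_point s \<in> word_polytope S"
  unfolding word_polytope_def by (rule hull_inc) (rule imageI)

lemma zero_in_word_polytope: "0 \<in> word_polytope S"
  using lattice_point_in_word_polytope[of 0] by simp

lemma compact_word_polytope: "compact (word_polytope S)"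
  unfolding word_polytope_def using fin by (intro finite_imp_compact_convex_hull) simp

lemma lmeasurable_dilate: "(*\<^sub>R) t ` word_polytope S \<in> lmeasurable"
  by (intro lmeasurable_compact compact_scaling compact_word_polytope)

text \<open>Each letter of a shortest word is a point of the polytope, so by convexity every letter
  raises the dilation factor by 1.\<close>

lemma lattice_point_in_dilate:
  "lattice_point x \<in> (*\<^sub>R) (real (word_length S x)) ` word_polytope S"
proof -
  have "set w \<subseteq> S \<Longrightarrow> lattice_point (sum_list w) \<in> (*\<^sub>R) (real (length w)) ` word_polytope S" for w
  proof (induction w)
    case Nil
    then show ?case
      using zero_in_word_polytope by force
  next
    case (Cons s w)
    then have "lattice_point s \<in> (*\<^sub>R) 1 ` word_polytope S"
      using lattice_point_in_word_polytope by auto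
    with Cons have "lattice_point s + lattice_point (sum_list w)
        \<in> (*\<^sub>R) (1 + real (length w)) ` word_polytope S"
      by (intro convex_dilate_add convex_word_polytope) auto
    then show ?case
      by (simp add: lattice_point_add)
  qed
  then show ?thesis
    using word_lengthE[OF sym gen, of x] by metis
qed

lemma word_length_multiple:
  assumes "s \<in> insert 0 S"
  shows "word_length S (int k *s s) \<le> k"
proof (induction k)
  case 0
  then show ?case
    by (simp add: word_length_zero[OF sym gen])
next
  case (Suc k)
  have "word_length S s \<le> 1"
    using assms word_length_le[of "[s]" S] word_length_zero[OF sym gen] by auto
  moreover have eq: "int (Suc k) *s s = int k *s s + s"
    by (simp add: vec_eq_iff algebra_simps)
  ultimately show ?case
    using word_length_add[OF sym gen, of "int k *s s" s] Suc.IH unfolding eq by linarith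
qed

text \<open>Rounding down the coefficients of a convex combination over \<open>S\<close> leaves a remainder from
  a finite set of lattice points that depends neither on \<open>x\<close> nor on \<open>t\<close>.\<close>

lemma word_length_le_dilate:
  "\<exists>C\<ge>0. \<forall>x t. 0 \<le> t \<longrightarrow> lattice_point x \<in> (*\<^sub>R) t ` word_polytope S
     \<longrightarrow> real (word_length S x) \<le> t + C"
proof -
  let ?T = "insert 0 S"
  \<comment> \<open>\<open>M\<close> dominates every coordinate of a combination of the generators
    with coefficients in \<open>[0, 1)\<close>, hence every rounding remainder.\<close>
  define M :: int where "M = (\<Sum>s\<in>?T. \<Sum>i\<in>UNIV. \<bar>s $ i\<bar>)"
  define Z where "Z = {z :: int ^ 'd. \<forall>i. \<bar>z $ i\<bar> \<le> M}"
  \<comment> \<open>Summing over the finite set \<open>Z\<close> is a crude substitute for the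
    maximal word length on it.\<close>
  define C where "C = (\<Sum>z\<in>Z. word_length S z)"
  have finT: "finite ?T" using fin by simp
  have "real (word_length S x) \<le> t + real C"
    if t: "0 \<le> t" and x: "lattice_point x \<in> (*\<^sub>R) t ` word_polytope S" for x t
  proof -
    obtain u where u: "\<And>v. v \<in> lattice_point ` ?T \<Longrightarrow> 0 \<le> u v" "sum u (lattice_point ` ?T) = 1"
      "lattice_point x = t *\<^sub>R (\<Sum>v\<in>lattice_point ` ?T. u v *\<^sub>R v)"
      using x finT unfolding word_polytope_def by (auto simp: convex_hull_finite)
    define a where "a s = t * u (lattice_point s)" for s
    have inj: "inj_on lattice_point ?T"
      using inj_lattice_point by (rule inj_on_subset) simp
    have a_nonneg: "a s \<ge> 0" if "s \<in> ?T" for s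
      using u(1)[OF imageI[OF that]] t by (simp add: a_def)
    have "(\<Sum>s\<in>?T. u (lattice_point s)) = 1"
      using u(2) unfolding sum.reindex[OF inj] o_def .
    then have a_sum: "(\<Sum>s\<in>?T. a s) = t"
      unfolding a_def sum_distrib_left[symmetric] by simp
    have x_eq: "lattice_point x = (\<Sum>s\<in>?T. a s *\<^sub>R lattice_point s)"
      using u(3) unfolding sum.reindex[OF inj] by (simp add: a_def scaleR_sum_right del: sum.insert)
    define y where "y = (\<Sum>s\<in>?T. \<lfloor>a s\<rfloor> *s s)"
    \<comment> \<open>What rounding leaves is the combination with coefficients
      \<open>frac (a s)\<close>.\<close>
    have "x - y \<in> Z"
      unfolding Z_def
    proof (intro CollectI allI)
      fix i
      have "real_of_int ((x - y) $ i) = lattice_point x $ i - real_of_int (y $ i)"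
        by simp
      also have "\<dots> = (\<Sum>s\<in>?T. frac (a s) * real_of_int (s $ i))"
        unfolding x_eq y_def
        by (simp add: sum_component frac_def left_diff_distrib sum_subtractf del: sum.insert)
      finally have "\<bar>real_of_int ((x - y) $ i)\<bar> \<le> (\<Sum>s\<in>?T. \<bar>frac (a s) * real_of_int (s $ i)\<bar>)"
        by (simp only: sum_abs)
      also have "\<dots> \<le> (\<Sum>s\<in>?T. real_of_int (\<Sum>i\<in>UNIV. \<bar>s $ i\<bar>))"
      proof (rule sum_mono)
        fix s
        have "\<bar>frac (a s) * real_of_int (s $ i)\<bar> \<le> 1 * \<bar>real_of_int (s $ i)\<bar>"
          unfolding abs_mult using frac_lt_1[of "a s"] frac_ge_0[of "a s"]
          by (intro mult_right_mono) auto
        also have "\<dots> \<le> real_of_int (\<Sum>i\<in>UNIV. \<bar>s $ i\<bar>)"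
          unfolding mult_1 of_int_abs[symmetric] of_int_le_iff by (rule member_le_sum) auto
        finally show "\<bar>frac (a s) * real_of_int (s $ i)\<bar> \<le> real_of_int (\<Sum>i\<in>UNIV. \<bar>s $ i\<bar>)" .
      qed
      also have "\<dots> = real_of_int M"
        by (simp add: M_def del: sum.insert)
      finally show "\<bar>(x - y) $ i\<bar> \<le> M"
        by linarith
    qed
    then have rem: "word_length S (x - y) \<le> C"
      unfolding C_def using finite_bounded_int_vectors[of M]
      by (intro member_le_sum) (auto simp: Z_def)
    \<comment> \<open>The rounded part uses \<open>\<lfloor>a s\<rfloor>\<close> copies of each
      \<open>s\<close>, and the \<open>a s\<close> add up to \<open>t\<close>.\<close>
    have "real (word_length S y) \<le> real (\<Sum>s\<in>?T. word_length S (\<lfloor>a s\<rfloor> *s s))"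
      unfolding y_def using word_length_sum[OF sym gen] by (rule of_nat_mono)
    also have "\<dots> \<le> (\<Sum>s\<in>?T. a s)"
      unfolding of_nat_sum
    proof (rule sum_mono)
      fix s assume s: "s \<in> ?T"
      have "\<lfloor>a s\<rfloor> = int (nat \<lfloor>a s\<rfloor>)"
        using a_nonneg[OF s] by simp
      then have "word_length S (\<lfloor>a s\<rfloor> *s s) \<le> nat \<lfloor>a s\<rfloor>"
        using word_length_multiple[OF s, of "nat \<lfloor>a s\<rfloor>"] by metis
      then show "real (word_length S (\<lfloor>a s\<rfloor> *s s)) \<le> a s"
        using a_nonneg[OF s] by linarith
    qed
    finally have "real (word_length S y) \<le> t"
      using a_sum by simp
    then show ?thesis
      using rem word_length_add[OF sym gen, of y "x - y"] by simp
  qed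
  then show ?thesis
    by (intro exI[of _ "real C"]) auto
qed

text \<open>Each signed unit vector has some word length and so lies in the corresponding dilate;
  scaling by a coordinate of size at most 1 and adding over the coordinates gives \<open>C\<close>.
  The result absorbs displacements within a unit cube and shows that the polytope has
  volume.\<close>

lemma cube_subset_dilate:
  "\<exists>C\<ge>0. \<forall>y. (\<forall>i. \<bar>y $ i\<bar> \<le> 1) \<longrightarrow> y \<in> (*\<^sub>R) C ` word_polytope S"
proof -
  \<comment> \<open>Adding the lengths for both signs bounds whichever sign the coordinate
    has.\<close>
  define N where "N i = real (word_length S (axis i 1)) + real (word_length S (axis i (- 1)))" for i :: 'd
  have "y \<in> (*\<^sub>R) (\<Sum>i\<in>UNIV. N i) ` word_polytope S" if y: "\<forall>i. \<bar>y $ i\<bar> \<le> 1" for y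
  proof -
    have "(y $ i) *\<^sub>R axis i 1 \<in> (*\<^sub>R) (N i) ` word_polytope S" for i
    proof -
      define e :: int where "e = (if y $ i \<ge> 0 then 1 else - 1)"
      have "lattice_point (axis i e) \<in> (*\<^sub>R) (real (word_length S (axis i e))) ` word_polytope S"
        by (rule lattice_point_in_dilate)
      then obtain k where k: "k \<in> word_polytope S"
        "lattice_point (axis i e) = real (word_length S (axis i e)) *\<^sub>R k"
        by blast
      have "(y $ i) *\<^sub>R axis i 1 = \<bar>y $ i\<bar> *\<^sub>R lattice_point (axis i e)"
        by (auto simp: vec_eq_iff axis_def e_def)
      then have in_dilate: "(y $ i) *\<^sub>R axis i 1
          \<in> (*\<^sub>R) (\<bar>y $ i\<bar> * real (word_length S (axis i e))) ` word_polytope S"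
        using k by auto
      have "\<bar>y $ i\<bar> * real (word_length S (axis i e)) \<le> 1 * N i"
        using y by (intro mult_mono) (auto simp: N_def e_def)
      then show ?thesis
        using convex_dilate_mono[OF convex_word_polytope zero_in_word_polytope _ _ in_dilate] by simp
    qed
    then have "(\<Sum>i\<in>UNIV. (y $ i) *\<^sub>R axis i 1) \<in> (*\<^sub>R) (\<Sum>i\<in>UNIV. N i) ` word_polytope S"
      by (intro convex_dilate_sum convex_word_polytope zero_in_word_polytope) (auto simp: N_def)
    moreover have "(\<Sum>i\<in>UNIV. (y $ i) *\<^sub>R axis i 1) = y"
      using basis_expansion[of y] by (simp add: scalar_mult_eq_scaleR)
    ultimately show ?thesis
      by simp
  qed
  then show ?thesis
    by (intro exI[of _ "\<Sum>i\<in>UNIV. N i"]) (auto simp: N_def intro: sum_nonneg)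
qed

text \<open>Some dilate contains a unit cube, so the volume cannot vanish.\<close>

lemma measure_word_polytope_pos: "measure lebesgue (word_polytope S) > 0"
proof -
  obtain C where C: "C \<ge> 0" "\<And>y. (\<And>i. \<bar>y $ i\<bar> \<le> 1) \<Longrightarrow> y \<in> (*\<^sub>R) C ` word_polytope S"
    using cube_subset_dilate by blast
  have "cbox 0 (0 + 1) \<subseteq> (*\<^sub>R) C ` word_polytope S"
    using C(2) by (fastforce simp: mem_box_cart)
  then have "measure lebesgue (cbox 0 (0 + 1 :: real ^ 'd)) \<le> measure lebesgue ((*\<^sub>R) C ` word_polytope S)"
    using lmeasurable_dilate by (intro measure_mono_fmeasurable) auto
  then have "1 \<le> C ^ CARD('d) * measure lebesgue (word_polytope S)"
    unfolding measure_unit_cube measure_dilate[OF C(1)] .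
  then show ?thesis
    by (auto simp: zero_less_measure_iff)
qed

section \<open>Growth of the balls\<close>

text \<open>The unit cubes at the points of the ball lie in the dilate by \<open>n + C\<close>, and
  they cover the dilate by \<open>n - (C + D)\<close>. Here \<open>C\<close> pays for moving within
  a cube and \<open>D\<close> for passing from a dilate back to word length.\<close>

lemma card_word_ball_tendsto:
  "(\<lambda>n. card (word_ball S n) / real n ^ CARD('d)) \<longlonglongrightarrow> measure lebesgue (word_polytope S)"
proof -
  obtain C where C: "C \<ge> 0" "\<And>y. (\<And>i. \<bar>y $ i\<bar> \<le> 1) \<Longrightarrow> y \<in> (*\<^sub>R) C ` word_polytope S"
    using cube_subset_dilate by blast
  obtain D where D: "D \<ge> 0" "\<And>x t. 0 \<le> t \<Longrightarrow> lattice_point x \<in> (*\<^sub>R) t ` word_polytope S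
      \<Longrightarrow> real (word_length S x) \<le> t + D"
    using word_length_le_dilate by blast
  have fin_ball: "finite (word_ball S n)" for n
    by (rule finite_word_ball[OF fin sym gen])
  show ?thesis
  proof (rule power_sandwich_tendsto[where c = "C + D"])
    fix n
    have "real (card (word_ball S n)) \<le> measure lebesgue ((*\<^sub>R) (real n + C) ` word_polytope S)"
    proof (intro card_le_measure fin_ball lmeasurable_dilate subsetI)
      fix x z assume x: "x \<in> word_ball S n"
        and z: "z \<in> box (lattice_point x) (lattice_point x + 1)"
      have "lattice_point x \<in> (*\<^sub>R) (real n) ` word_polytope S"
        using x convex_dilate_mono[OF convex_word_polytope zero_in_word_polytope
            _ _ lattice_point_in_dilate] by (auto simp: word_ball_def)
      moreover have "\<bar>(z - lattice_point x) $ i\<bar> \<le> 1" for i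
        using z[unfolded mem_box_cart, rule_format, of i] by auto
      then have "z - lattice_point x \<in> (*\<^sub>R) C ` word_polytope S"
        by (rule C(2))
      ultimately have "lattice_point x + (z - lattice_point x) \<in> (*\<^sub>R) (real n + C) ` word_polytope S"
        using C(1) by (intro convex_dilate_add convex_word_polytope) auto
      then show "z \<in> (*\<^sub>R) (real n + C) ` word_polytope S"
        by simp
    qed
    also have "\<dots> = (real n + C) ^ CARD('d) * measure lebesgue (word_polytope S)"
      using C(1) by (intro measure_dilate) simp
    also have "\<dots> \<le> (real n + (C + D)) ^ CARD('d) * measure lebesgue (word_polytope S)"
      using C(1) D(1) by (intro mult_right_mono power_mono) auto
    finally show "real (card (word_ball S n))
        \<le> (real n + (C + D)) ^ CARD('d) * measure lebesgue (word_polytope S)" .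
  next
    fix n assume n: "C + D \<le> real n"
    \<comment> \<open>Chosen so that \<open>t + C + D\<close> is exactly \<open>n\<close>.\<close>
    define t where "t = real n - (C + D)"
    have t: "t \<ge> 0" using n by (simp add: t_def)
    have "measure lebesgue ((*\<^sub>R) t ` word_polytope S) \<le> real (card (word_ball S n))"
    proof (intro measure_le_card fin_ball lmeasurable_dilate subsetI)
      fix y assume y: "y \<in> (*\<^sub>R) t ` word_polytope S"
      \<comment> \<open>The lowest corner of a lattice cube containing \<open>y\<close>.\<close>
      define x :: "int ^ 'd" where "x = (\<chi> i. \<lfloor>y $ i\<rfloor>)"
      have "\<bar>(lattice_point x - y) $ i\<bar> \<le> 1" for i
        by (simp add: x_def) linarith
      then have "lattice_point x - y \<in> (*\<^sub>R) C ` word_polytope S"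
        by (rule C(2))
      then have "y + (lattice_point x - y) \<in> (*\<^sub>R) (t + C) ` word_polytope S"
        using y t C(1) by (intro convex_dilate_add convex_word_polytope) auto
      then have "real (word_length S x) \<le> t + C + D"
        using t C(1) by (intro D(2)) auto
      then have "x \<in> word_ball S n"
        by (simp add: t_def word_ball_def)
      moreover have "y \<in> cbox (lattice_point x) (lattice_point x + 1)"
        by (auto simp: mem_box_cart x_def)
      ultimately show "y \<in> (\<Union>x\<in>word_ball S n. cbox (lattice_point x) (lattice_point x + 1))"
        by blast
    qed
    then show "(real n - (C + D)) ^ CARD('d) * measure lebesgue (word_polytope S)
        \<le> real (card (word_ball S n))"
      using measure_dilate[OF t, of "word_polytope S"] by (simp add: t_def)
  qed
qed

end

section \<open>The limit of the normalized moments\<close>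

theorem corollary5p2:
  fixes S :: "(int ^ 'd) set" and p :: real
  assumes "finite S"
    and "uminus ` S = S"
    and "group_closure S = UNIV"
    and "p > 0"
  shows "(\<lambda>n. 1 / real (card (word_ball S n)) *
            (\<Sum>x\<in>word_ball S n. real (word_length S x) powr p / real n powr p))
         \<longlonglongrightarrow> real CARD('d) / (real CARD('d) + p)"
proof -
  have "(\<lambda>n. card (word_ball S n) / real n powr real CARD('d))
      \<longlonglongrightarrow> measure lebesgue (word_polytope S)"
  \<comment> \<open>The growth of the balls is stated with natural powers, the moment asymptotics
    with \<open>powr\<close>; \<open>powr_realpow\<close> identifies them for a positive
    base.\<close>
  proof (rule Lim_transform_eventually[OF card_word_ball_tendsto[OF assms(1-3)]])
    show "\<forall>\<^sub>F n in sequentially. card (word_ball S n) / real n ^ CARD('d)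
        = card (word_ball S n) / real n powr real CARD('d)"
      using eventually_gt_at_top[of 0] by eventually_elim (simp add: powr_realpow)
  qed
  then show ?thesis
    using normalized_moment_tendsto[of "word_length S" "real CARD('d)" p]
      finite_word_ball[OF assms(1-3)] measure_word_polytope_pos[OF assms(1-3)] assms(4)
    by (simp add: word_ball_def)
qed

end
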